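(* Let $Y$ be a real Banach space. Then $\mathrm{D}_{\mathcal K}(\mathbb{R},Y)$ is dense in $\mathrm{Lip}_{0\mathcal K}(\mathbb{R},Y)$.
   Context: For real Banach spaces $X,Y$, $\mathrm{Lip}_0(X,Y)$ is the Banach space of Lipschitz maps $f\colon X\to Y$ with $f(0)=0$, normed by $\|f\|=\sup\{\|f(x)-f(y)\|/\|x-y\|: x\neq y\}$. A map $f\in\mathrm{Lip}_0(X,Y)$ is Lipschitz compact if its set of slopes $\{\frac{f(x)-f(y)}{\|x-y\|}: x,y\in X, x\neq y\}$ is relatively compact in $Y$; $\mathrm{Lip}_{0\mathcal K}(X,Y)$ is the (normed) subspace of Lipschitz compact maps. $\mathrm{D}(X,Y)$ denotes the set of $f\in\mathrm{Lip}_0(X,Y)$ for which there exist $x\in X$ and $e\in S_X$ such that $f'(x,e)=\lim_{t\to0}\frac{f(x+te)-f(x)}{t}$ exists in $Y$ and $\|f'(x,e)\|=\|f\|$; $\mathrm{D}_{\mathcal K}(X,Y)=\mathrm{D}(X,Y)\cap\mathrm{Lip}_{0\mathcal K}(X,Y)$. *)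

theory Defs
  imports "HOL-Analysis.Analysis"
begin

definition lip0 :: "('a::real_normed_vector \<Rightarrow> 'b::real_normed_vector) \<Rightarrow> bool" where
  "lip0 f \<longleftrightarrow> f 0 = 0 \<and> (\<exists>L. \<forall>x y. norm (f x - f y) \<le> L * norm (x - y))"

definition lip_norm :: "('a::real_normed_vector \<Rightarrow> 'b::real_normed_vector) \<Rightarrow> real" where
  "lip_norm f = Sup {norm (f x - f y) / norm (x - y) | x y. x \<noteq> y}"

definition slopes :: "('a::real_normed_vector \<Rightarrow> 'b::real_normed_vector) \<Rightarrow> 'b set" where
  "slopes f = {(f x - f y) /\<^sub>R norm (x - y) | x y. x \<noteq> y}"

definition lip0K :: "('a::real_normed_vector \<Rightarrow> 'b::real_normed_vector) \<Rightarrow> bool" where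
  "lip0K f \<longleftrightarrow> lip0 f \<and> compact (closure (slopes f))"

definition DD :: "('a::real_normed_vector \<Rightarrow> 'b::real_normed_vector) \<Rightarrow> bool" where
  "DD f \<longleftrightarrow> lip0 f \<and> (\<exists>x e d. norm e = 1 \<and>
      ((\<lambda>t::real. (f (x + t *\<^sub>R e) - f x) /\<^sub>R t) \<longlongrightarrow> d) (at 0) \<and>
      norm d = lip_norm f)"

definition DK :: "('a::real_normed_vector \<Rightarrow> 'b::real_normed_vector) \<Rightarrow> bool" where
  "DK f \<longleftrightarrow> DD f \<and> lip0K f"

end

(* Cover the slopes of f by finitely many balls of radius \<delta> with centres y i. Every x has, for some i,
   arbitrarily small t > 0 whose right slope at x lies in the i-th ball; these sets of points are G_delta, and making
   them disjoint gives a measurable partition A i of the line. The primitive g of the simple function with value y i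
   on A i is \<delta>-close to f: since (f - g) has slopes of norm at most \<delta> at arbitrarily small scales, up to
   errors living on a set of small measure, a continuity induction along the line gives the global bound, so f itself
   need not be shown to be differentiable anywhere. Finally, g attains its norm at a density point of
   the set A i with the largest norm y i among those of positive measure. *)

theory Submission
  imports Defs
begin

section \<open>Continuity induction and measurability of slope conditions\<close>

text \<open>The supremum of the good points is itself good by closedness, and below \<open>b\<close>
  the step would produce a good point beyond it. The step has to supply just one larger good point,
  not a whole interval; this suits \<open>prim_approx\<close>, where only some arbitrarily small
  increments are controlled.\<close>

lemma closed_real_induct:
  fixes a b :: real
  assumes "a \<le> b" "closed {x \<in> {a..b}. P x}" "P a"
    and step: "\<And>c. \<lbrakk>a \<le> c; c < b; P c\<rbrakk> \<Longrightarrow> \<exists>d. c < d \<and> d \<le> b \<and> P d"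
  shows "P b"
proof -
  let ?S = "{x \<in> {a..b}. P x}"
  have bdd: "bdd_above ?S" by (rule bdd_aboveI[of _ b]) auto
  have mem: "Sup ?S \<in> ?S"
    using assms bdd by (intro closed_contains_Sup) auto
  show ?thesis
  proof (rule ccontr)
    assume "\<not> P b"
    with mem have "a \<le> Sup ?S" "Sup ?S < b" "P (Sup ?S)"
      by (auto simp: less_le)
    then obtain d where d: "Sup ?S < d" "d \<le> b" "P d" using step by blast
    with \<open>a \<le> Sup ?S\<close> have "d \<in> ?S" by auto
    then have "d \<le> Sup ?S" using bdd by (rule cSup_upper)
    with d show False by simp
  qed
qed

text \<open>For fixed \<open>t\<close> the condition is open in \<open>x\<close> by continuity of
  \<open>h\<close>. A union of open sets over an arbitrary, possibly uncountable \<open>T m\<close>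
  is again open, so the set is a G_delta.\<close>

lemma frequent_slope_set_borel:
  fixes h :: "real \<Rightarrow> 'a::real_normed_vector" and T :: "nat \<Rightarrow> real set"
  assumes "continuous_on UNIV h"
  shows "{x. \<forall>m. \<exists>t\<in>T m. norm ((h (x + t) - h x) /\<^sub>R t - y) < q} \<in> sets borel"
proof -
  have "{x. \<forall>m. \<exists>t\<in>T m. norm ((h (x + t) - h x) /\<^sub>R t - y) < q} =
      (\<Inter>m. \<Union>t\<in>T m. {x. norm ((h (x + t) - h x) /\<^sub>R t - y) < q})"
    by auto
  moreover have "open {x. norm ((h (x + t) - h x) /\<^sub>R t - y) < q}" for t
    by (intro open_Collect_less continuous_intros continuous_on_compose2[OF assms]) auto
  then have "open (\<Union>t\<in>T m. {x. norm ((h (x + t) - h x) /\<^sub>R t - y) < q})" for m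
    by blast
  ultimately show ?thesis by simp
qed

subsection \<open>Lebesgue density\<close>

text \<open>Vitali covering: disjoint balls of density at most \<open>q\<close> exhaust a bounded
  piece \<open>B\<close> of \<open>S\<close> up to a null set, and they stay inside an open
  \<open>U\<close> exceeding \<open>B\<close> by at most \<open>e\<close>. Hence |B| \<le> q (|B| +
  e) for every \<open>e\<close>, which forces |B| = 0 as q < 1. The balls must contain
  \<open>x\<close> but need not be centred there, so one-sided intervals at \<open>x\<close> are
  admissible.\<close>

lemma negligible_upper_density:
  fixes S :: "'a::euclidean_space set"
  assumes S: "S \<in> sets lebesgue" and q: "0 \<le> q" "q < 1"
    and dens: "\<And>x d. \<lbrakk>x \<in> S; 0 < d\<rbrakk> \<Longrightarrow> \<exists>a r. x \<in> cball a r \<and> 0 < r \<and> r < d \<and>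
        measure lebesgue (S \<inter> cball a r) \<le> q * measure lebesgue (cball a r)"
  shows "negligible S"
proof -
  have "negligible (S \<inter> cbox u v)" for u v
  proof -
    define B where "B = S \<inter> cbox u v"
    have B: "B \<in> lmeasurable" unfolding B_def
      using S fmeasurable_Int_fmeasurable[of "cbox u v" lebesgue S] by (simp add: Int_commute)
    have le: "measure lebesgue B \<le> q * (measure lebesgue B + e)" if e: "e > 0" for e
    proof -
      obtain U where U: "open U" "B \<subseteq> U" "U - B \<in> lmeasurable" "emeasure lebesgue (U - B) < ennreal e"
        using sets_lebesgue_outer_open[of B e] B e by (auto simp: fmeasurableD)
      have Um: "U \<in> lmeasurable"
        using fmeasurable.Un[OF B U(3)] U(2) by (simp add: Un_absorb1)
      have "measure lebesgue (U - B) \<le> e"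
        using U(4) e by (simp add: measure_def enn2real_leI less_imp_le)
      then have Ue: "measure lebesgue U \<le> measure lebesgue B + e"
        using measure_Un2[OF B U(3)] U(2) by (simp add: Un_absorb1 Diff_Int_distrib Diff_triv)
      define K where "K = {(a,r). 0 < r \<and> cball a r \<subseteq> U \<and>
          measure lebesgue (S \<inter> cball a r) \<le> q * measure lebesgue (cball a r)}"
      have K: "\<exists>i. i \<in> K \<and> x \<in> cball (fst i) (snd i) \<and> snd i < d" if x: "x \<in> B" "0 < d" for x d
      proof -
        obtain s where s: "s > 0" "ball x s \<subseteq> U" using U x by (meson openE subsetD)
        \<comment> \<open>The ball contains \<open>x\<close> off centre, so its points are within 2r
          of \<open>x\<close>; radius below s/2 keeps it inside \<open>ball x s\<close>.\<close>
        obtain a r where ar: "x \<in> cball a r" "0 < r" "r < min d (s/2)"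
          "measure lebesgue (S \<inter> cball a r) \<le> q * measure lebesgue (cball a r)"
          using dens[of x "min d (s/2)"] x s by (auto simp: B_def)
        have "cball a r \<subseteq> ball x s"
        proof
          fix z assume "z \<in> cball a r"
          then have "dist x z \<le> r + r" using ar(1) dist_triangle2[of x z a]
            by (simp add: dist_commute)
          then show "z \<in> ball x s" using ar by simp
        qed
        with s have "(a,r) \<in> K" using ar by (auto simp: K_def)
        with ar show ?thesis by (intro exI[of _ "(a,r)"]) auto
      qed
      have pos: "0 < snd i" if "i \<in> K" for i using that by (auto simp: K_def)
      obtain C where C: "countable C" "C \<subseteq> K"
          "pairwise (\<lambda>i j. disjnt (cball (fst i) (snd i)) (cball (fst j) (snd j))) C"
          "negligible (B - (\<Union>i\<in>C. cball (fst i) (snd i)))"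
        by (rule Vitali_covering_theorem_cballs[of K snd B fst, OF pos K])
      let ?c = "\<lambda>i. cball (fst i) (snd i)"
      have disj: "disjoint_family_on ?c C"
        using C(3) by (auto simp: disjoint_family_on_def pairwise_def disjnt_def)
      have "emeasure lebesgue B \<le> emeasure lebesgue (B \<inter> (\<Union>i\<in>C. ?c i)) + emeasure lebesgue (B - (\<Union>i\<in>C. ?c i))"
      proof -
        have "(\<Union>i\<in>C. ?c i) \<in> sets lebesgue" using C(1) by (intro sets.countable_UN'') auto
        then show ?thesis using B
          by (subst plus_emeasure) (auto simp: fmeasurableD Int_Diff_Un)
      qed
      also have "emeasure lebesgue (B - (\<Union>i\<in>C. ?c i)) = 0"
        using C(4) by (simp add: negligible_iff_null_sets null_setsD1)
      also have "emeasure lebesgue (B \<inter> (\<Union>i\<in>C. ?c i)) = emeasure lebesgue (\<Union>i\<in>C. B \<inter> ?c i)"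
        by (simp only: Int_UN_distrib)
      also have "\<dots> = (\<integral>\<^sup>+i. emeasure lebesgue (B \<inter> ?c i) \<partial>count_space C)"
      proof (rule emeasure_UN_countable)
        show "disjoint_family_on (\<lambda>i. B \<inter> ?c i) C"
          using disj unfolding disjoint_family_on_def by blast
      qed (use B C(1) in \<open>auto simp: fmeasurableD\<close>)
      also have "\<dots> \<le> (\<integral>\<^sup>+i. ennreal q * emeasure lebesgue (?c i) \<partial>count_space C)"
      proof (rule nn_integral_mono)
        fix i assume "i \<in> space (count_space C)"
        then have i: "i \<in> K" using C by auto
        have "emeasure lebesgue (B \<inter> ?c i) \<le> emeasure lebesgue (S \<inter> ?c i)"
          using S by (intro emeasure_mono) (auto simp: B_def)
        also have "\<dots> = ennreal (measure lebesgue (S \<inter> ?c i))"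
          using S fmeasurable_Int_fmeasurable[of "?c i" lebesgue S]
          by (intro emeasure_eq_measure2) (simp add: Int_commute)
        also have "\<dots> \<le> ennreal (q * measure lebesgue (?c i))"
          using i by (intro ennreal_leI) (auto simp: K_def)
        also have "\<dots> = ennreal q * emeasure lebesgue (?c i)"
          using q by (simp add: ennreal_mult emeasure_eq_measure2 lmeasurable_cball)
        finally show "emeasure lebesgue (B \<inter> ?c i) \<le> ennreal q * emeasure lebesgue (?c i)" .
      qed
      also have "\<dots> = ennreal q * (\<integral>\<^sup>+i. emeasure lebesgue (?c i) \<partial>count_space C)"
        by (rule nn_integral_cmult) auto
      also have "(\<integral>\<^sup>+i. emeasure lebesgue (?c i) \<partial>count_space C) = emeasure lebesgue (\<Union>i\<in>C. ?c i)"
        using C(1) disj by (intro emeasure_UN_countable[symmetric]) auto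
      also have "\<dots> \<le> emeasure lebesgue U"
        using C(2) Um by (intro emeasure_mono) (auto simp: K_def fmeasurableD subset_iff)
      finally have "emeasure lebesgue B \<le> ennreal q * emeasure lebesgue U"
        by (simp add: mult_left_mono)
      then have "measure lebesgue B \<le> q * measure lebesgue U"
        using q B Um by (simp add: emeasure_eq_measure2 flip: ennreal_mult)
      also have "\<dots> \<le> q * (measure lebesgue B + e)"
        using Ue q by (intro mult_left_mono)
      finally show ?thesis .
    qed
    have "measure lebesgue B \<le> q * measure lebesgue B"
    proof (rule field_le_epsilon)
      fix e :: real assume "e > 0"
      moreover from this have "q * e \<le> e" using q by simp
      ultimately show "measure lebesgue B \<le> q * measure lebesgue B + e"
        using le[OF \<open>e > 0\<close>] by (simp only: distrib_left)
    qed
    then have "(1 - q) * measure lebesgue B \<le> 0" by (simp add: algebra_simps)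
    then have "measure lebesgue B = 0"
      using q by (simp add: mult_le_0_iff antisym)
    then show ?thesis using B by (simp add: negligible_iff_measure B_def)
  qed
  then show ?thesis by (subst negligible_on_intervals) blast
qed

section \<open>The distribution function of a measurable set of reals\<close>

text \<open>For measurable \<open>S\<close> this is the integral of the indicator of
  \<open>S\<close> from 0 to \<open>x\<close>, with the usual sign for negative \<open>x\<close>; at
  most one of the two terms is nonzero. Half-open intervals concatenate without overlap or gap,
  which makes increments additive.\<close>

definition cum :: "real set \<Rightarrow> real \<Rightarrow> real" where
  "cum S x = measure lebesgue (S \<inter> {0<..x}) - measure lebesgue (S \<inter> {x<..0})"

lemma lmeasurable_Int_interval:
  fixes a b :: real
  assumes "S \<in> sets lebesgue"
  shows "S \<inter> {a<..b} \<in> lmeasurable"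
  using assms by (intro fmeasurable_Int_fmeasurable bounded_set_imp_lmeasurable) auto

lemma cum_diff:
  assumes S: "S \<in> sets lebesgue" and "a \<le> b"
  shows "cum S b - cum S a = measure lebesgue (S \<inter> {a<..b})"
proof -
  note m = lmeasurable_Int_interval[OF S]
  have split: "measure lebesgue (S \<inter> {u<..w}) = measure lebesgue (S \<inter> {u<..v}) + measure lebesgue (S \<inter> {v<..w})"
    if "u \<le> v" "v \<le> w" for u v w
  proof -
    have eq: "S \<inter> {u<..w} = (S \<inter> {u<..v}) \<union> (S \<inter> {v<..w})" using that by auto
    show ?thesis unfolding eq by (rule measure_Un2[THEN trans]) (auto simp: m intro!: arg_cong[of _ _ "measure lebesgue"])
  qed
  consider "0 \<le> a" | "a \<le> 0" "0 \<le> b" | "b \<le> 0" using \<open>a \<le> b\<close> by linarith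
  then show ?thesis
  proof cases
    case 1
    then show ?thesis using split[OF 1 \<open>a \<le> b\<close>] \<open>a \<le> b\<close> by (simp add: cum_def)
  next
    case 2
    then show ?thesis using split[OF 2] by (simp add: cum_def)
  next
    case 3
    then show ?thesis using split[OF \<open>a \<le> b\<close> 3] \<open>a \<le> b\<close> by (simp add: cum_def)
  qed
qed

lemma cum_mono: "S \<in> sets lebesgue \<Longrightarrow> a \<le> b \<Longrightarrow> cum S a \<le> cum S b"
  using cum_diff[of S a b] measure_nonneg[of lebesgue "S \<inter> {a<..b}"] by linarith

lemma cum_diff_le: 
  assumes "S \<in> sets lebesgue" "a \<le> b"
  shows "cum S b - cum S a \<le> b - a"
proof -
  have "measure lebesgue (S \<inter> {a<..b}) \<le> measure lebesgue {a<..b}"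
    using assms bounded_set_imp_lmeasurable[of "{a<..b}"] by (intro measure_mono_fmeasurable) auto
  then show ?thesis using assms by (simp add: cum_diff)
qed

lemma cum_slope_bounds:
  assumes S: "S \<in> sets lebesgue" and "t \<noteq> 0"
  shows "0 \<le> (cum S (x + t) - cum S x) / t" "(cum S (x + t) - cum S x) / t \<le> 1"
proof -
  have "0 \<le> (cum S (x + t) - cum S x) / t \<and> (cum S (x + t) - cum S x) / t \<le> 1"
  proof (cases "t > 0")
    case True
    then show ?thesis using cum_mono[OF S, of x "x + t"] cum_diff_le[OF S, of x "x + t"] by simp
  next
    case False
    then show ?thesis using \<open>t \<noteq> 0\<close> cum_mono[OF S, of "x + t" x] cum_diff_le[OF S, of "x + t" x]
      by (auto simp: divide_simps)
  qed
  then show "0 \<le> (cum S (x + t) - cum S x) / t" "(cum S (x + t) - cum S x) / t \<le> 1" by auto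
qed

lemma continuous_on_cum:
  assumes S: "S \<in> sets lebesgue"
  shows "continuous_on T (cum S)"
proof -
  have "dist (cum S x) (cum S y) \<le> 1 * dist x y" for x y
    using cum_mono[OF S, of x y] cum_diff_le[OF S, of x y]
      cum_mono[OF S, of y x] cum_diff_le[OF S, of y x]
    by (cases "x \<le> y") (auto simp: dist_real_def)
  then have "1-lipschitz_on T (cum S)" by (intro lipschitz_onI) auto
  then show ?thesis by (rule lipschitz_on_continuous_on)
qed

text \<open>An existence form of the Lebesgue density theorem. Points of \<open>A\<close> whose
  slopes drop below 1 - 1/(m+1) at arbitrarily small scales are negligible by
  \<open>negligible_upper_density\<close>. Discarding these for all \<open>m\<close> leaves a point
  of \<open>A\<close>, and there the upper bound 1 on slopes gives the limit.\<close>

lemma density_point_exists: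
  assumes A: "A \<in> sets lebesgue" and "\<not> negligible A"
  obtains x where "x \<in> A" "((\<lambda>t. (cum A (x + t) - cum A x) / t) \<longlongrightarrow> 1) (at 0)"
proof -
  \<comment> \<open>Written with a norm and a subtracted 0 to match
    \<open>frequent_slope_set_borel\<close>; since slopes of \<open>cum\<close> are nonnegative, the
    norm changes nothing.\<close>
  define G where "G m = {x. \<forall>k. \<exists>t\<in>{t. t \<noteq> 0 \<and> \<bar>t\<bar> < 1 / Suc k}.
      norm ((cum A (x + t) - cum A x) /\<^sub>R t - 0) < 1 - 1 / Suc m}" for m :: nat
  have neg: "negligible (A \<inter> G m)" for m
  proof (rule negligible_upper_density[where q = "1 - 1 / Suc m"])
    have "G m \<in> sets borel" unfolding G_def
      by (rule frequent_slope_set_borel) (rule continuous_on_cum[OF A])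
    then show "A \<inter> G m \<in> sets lebesgue" using A by auto
    fix x d :: real assume x: "x \<in> A \<inter> G m" "0 < d"
    obtain k where k: "1 / Suc k < d" using x(2) nat_approx_posE by metis
    obtain t where t: "t \<noteq> 0" "\<bar>t\<bar> < 1 / Suc k"
      "norm ((cum A (x + t) - cum A x) /\<^sub>R t - 0) < 1 - 1 / Suc m"
      using x(1) unfolding G_def by blast
    \<comment> \<open>The interval between \<open>x\<close> and \<open>x + t\<close> for either sign
      of \<open>t\<close>; as a ball it has \<open>x\<close> on its boundary.\<close>
    define u v where "u = min x (x + t)" and "v = max x (x + t)"
    have uv: "u < v" "v - u = \<bar>t\<bar>" using t(1) by (auto simp: u_def v_def)
    have ball: "cball ((u + v) / 2) ((v - u) / 2) = {u..v}"
      by (simp add: cball_eq_atLeastAtMost add_divide_distrib diff_divide_distrib)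
    have "(cum A v - cum A u) / (v - u) = (cum A (x + t) - cum A x) / t"
      using t(1) by (auto simp: u_def v_def min_def max_def minus_divide_left simp flip: minus_divide_right)
    also have "\<dots> \<le> 1 - 1 / Suc m" using t(3) by (simp add: divide_inverse mult.commute)
    finally have le: "cum A v - cum A u \<le> (1 - 1 / Suc m) * (v - u)"
      using uv by (simp add: pos_divide_le_eq)
    have "measure lebesgue (A \<inter> G m \<inter> {u..v}) \<le> measure lebesgue (A \<inter> {u..v})"
      using A \<open>A \<inter> G m \<in> sets lebesgue\<close>
      by (intro measure_mono_fmeasurable)
         (auto simp: fmeasurable_Int_fmeasurable bounded_set_imp_lmeasurable Int_commute[of A])
    also have "\<dots> = measure lebesgue (A \<inter> {u<..v})"
    proof -
      have "sym_diff (A \<inter> {u<..v}) (A \<inter> {u..v}) \<subseteq> {u}" by auto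
      then have "negligible (sym_diff (A \<inter> {u<..v}) (A \<inter> {u..v}))"
        using negligible_subset negligible_sing by blast
      then show ?thesis
        by (intro measure_negligible_symdiff lmeasurable_Int_interval[OF A])
    qed
    also have "\<dots> = cum A v - cum A u" using uv by (simp add: cum_diff[OF A])
    finally have "measure lebesgue (A \<inter> G m \<inter> {u..v}) \<le> (1 - 1 / Suc m) * measure lebesgue {u..v}"
      using le uv(1) by simp
    moreover have "x \<in> {u..v}" by (simp add: u_def v_def)
    moreover have "0 < (v - u) / 2" using uv(1) by simp
    moreover have "(v - u) / 2 < d"
      using uv order.strict_trans[OF t(2) k] by simp
    ultimately show "\<exists>a r. x \<in> cball a r \<and> 0 < r \<and> r < d \<and>
        measure lebesgue (A \<inter> G m \<inter> cball a r) \<le> (1 - 1 / Suc m) * measure lebesgue (cball a r)"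
      unfolding ball[symmetric] by blast
  qed auto
  have "negligible (\<Union>m. A \<inter> G m)" using neg by (intro negligible_countable_Union) auto
  then have "\<not> A \<subseteq> (\<Union>m. A \<inter> G m)" using assms(2) negligible_subset by blast
  then obtain x where x: "x \<in> A" "\<And>m. x \<notin> G m" by auto
  have "((\<lambda>t. (cum A (x + t) - cum A x) / t) \<longlongrightarrow> 1) (at 0)"
    unfolding LIM_def
  proof (intro allI impI)
    fix e :: real assume "e > 0"
    then obtain m where m: "1 / Suc m < e" using nat_approx_posE by metis
    obtain k where k: "\<And>t. t \<noteq> 0 \<Longrightarrow> \<bar>t\<bar> < 1 / Suc k \<Longrightarrow>
        1 - 1 / Suc m \<le> norm ((cum A (x + t) - cum A x) /\<^sub>R t - 0)"
      using x(2)[of m] unfolding G_def by (fastforce simp: not_less)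
    have "dist ((cum A (x + t) - cum A x) / t) 1 < e" if t: "t \<noteq> 0" "dist t 0 < 1 / Suc k" for t
    proof -
      have "1 - 1 / Suc m \<le> \<bar>(cum A (x + t) - cum A x) / t\<bar>"
        using k[of t] t by (simp add: divide_inverse mult.commute)
      then show ?thesis using cum_slope_bounds[OF A t(1), of x] m
        by (simp add: dist_real_def)
    qed
    then show "\<exists>s>0. \<forall>t. t \<noteq> 0 \<and> dist t 0 < s \<longrightarrow> dist ((cum A (x + t) - cum A x) / t) 1 < e"
      by (intro exI[of _ "1 / Suc k"]) auto
  qed
  with x(1) show ?thesis by (rule that)
qed

subsection \<open>Primitives of simple functions\<close>

text \<open>Describes the simple function with value \<open>y i\<close> on \<open>A i\<close>. Null
  and empty pieces are permitted, so sharp norm bounds refer to the non-negligible pieces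
  only.\<close>

locale simple_partition =
  fixes I :: "'i set" and A :: "'i \<Rightarrow> real set" and y :: "'i \<Rightarrow> 'b::real_normed_vector"
  assumes finite_I: "finite I"
    and A_sets: "i \<in> I \<Longrightarrow> A i \<in> sets lebesgue"
    and A_disj: "disjoint_family_on A I"
    and A_cover: "(\<Union>i\<in>I. A i) = UNIV"
begin

text \<open>The primitive, vanishing at 0, of the simple function, written as a finite combination
  of scalar distribution functions in place of a vector-valued integral.\<close>

definition prim :: "real \<Rightarrow> 'b" where
  "prim x = (\<Sum>i\<in>I. cum (A i) x *\<^sub>R y i)"

text \<open>A crude bound for the diameter of the set of values; a sum is nonnegative without any
  case distinction.\<close>

definition spread :: real where
  "spread = 2 * (\<Sum>i\<in>I. norm (y i))"

lemma spread_nonneg: "0 \<le> spread"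
  unfolding spread_def by (simp add: sum_nonneg)

lemma norm_diff_le_spread: "i \<in> I \<Longrightarrow> j \<in> I \<Longrightarrow> norm (y j - y i) \<le> spread"
  using member_le_sum[of i I "\<lambda>i. norm (y i)"] member_le_sum[of j I "\<lambda>i. norm (y i)"]
    norm_triangle_ineq4[of "y j" "y i"] finite_I
  unfolding spread_def by simp

lemma prim_diff: "prim b - prim a = (\<Sum>i\<in>I. (cum (A i) b - cum (A i) a) *\<^sub>R y i)"
  by (simp add: prim_def scaleR_left_diff_distrib sum_subtractf)

lemma sum_cum_diff:
  assumes "a \<le> b"
  shows "(\<Sum>i\<in>I. cum (A i) b - cum (A i) a) = b - a"
proof -
  have m: "A i \<inter> {a<..b} \<in> lmeasurable" if "i \<in> I" for i
    using that by (intro lmeasurable_Int_interval A_sets)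
  have "(\<Sum>i\<in>I. cum (A i) b - cum (A i) a) = (\<Sum>i\<in>I. measure lebesgue (A i \<inter> {a<..b}))"
    using assms by (intro sum.cong) (auto simp: cum_diff A_sets)
  also have "\<dots> = measure lebesgue (\<Union>i\<in>I. A i \<inter> {a<..b})"
    using A_disj
    by (intro measure_UNION'[symmetric] finite_I m)
       (auto simp: disjoint_family_on_def pairwise_def disjnt_def)
  also have "(\<Union>i\<in>I. A i \<inter> {a<..b}) = {a<..b}" using A_cover by auto
  finally show ?thesis using assms by simp
qed

text \<open>The increment of \<open>prim\<close> weights each \<open>y j\<close> by the measure of
  \<open>A j\<close> in the interval, and the weights add up to b - a. After subtracting
  \<open>y i\<close> throughout, the i-th term vanishes and the remaining weight is the measure of
  the part outside \<open>A i\<close>.\<close>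

lemma prim_diff_near:
  assumes i: "i \<in> I" and "a \<le> b"
  shows "norm (prim b - prim a - (b - a) *\<^sub>R y i) \<le> spread * ((b - a) - (cum (A i) b - cum (A i) a))"
proof -
  define w where "w j = cum (A j) b - cum (A j) a" for j
  have w: "0 \<le> w j" if "j \<in> I" for j
    using cum_mono[OF A_sets[OF that] \<open>a \<le> b\<close>] by (simp add: w_def)
  have sw: "sum w I = b - a" unfolding w_def by (rule sum_cum_diff[OF \<open>a \<le> b\<close>])
  have "prim b - prim a - (b - a) *\<^sub>R y i = (\<Sum>j\<in>I. w j *\<^sub>R (y j - y i))"
    by (simp add: prim_diff scaleR_diff_right sum_subtractf flip: w_def sw scaleR_sum_left)
  also have "\<dots> = (\<Sum>j\<in>I - {i}. w j *\<^sub>R (y j - y i))"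
    using i finite_I by (simp add: sum.remove)
  also have "norm \<dots> \<le> (\<Sum>j\<in>I - {i}. w j * spread)"
    using w i by (intro sum_norm_le) (auto intro!: mult_left_mono norm_diff_le_spread)
  also have "\<dots> = spread * ((b - a) - w i)"
    using i finite_I by (simp add: sum_distrib_right[symmetric] sum_diff1 sw mult.commute)
  finally show ?thesis by (simp add: w_def)
qed

lemma prim_slope_near:
  assumes i: "i \<in> I" and "t \<noteq> 0"
  shows "norm ((prim (x + t) - prim x) /\<^sub>R t - y i) \<le> spread * (1 - (cum (A i) (x + t) - cum (A i) x) / t)"
proof -
  define p where "p = prim (x + t) - prim x"
  define c where "c = cum (A i) (x + t) - cum (A i) x"
  \<comment> \<open>For either sign of \<open>t\<close>, \<open>c * sgn t\<close> is the measure of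
    \<open>A i\<close> between \<open>x\<close> and \<open>x + t\<close>; negative \<open>t\<close>
    is handled by the interval from \<open>x + t\<close> to \<open>x\<close>.\<close>
  have "norm (p - t *\<^sub>R y i) \<le> spread * (\<bar>t\<bar> - c * sgn t)"
  proof (cases "t > 0")
    case True
    then show ?thesis using prim_diff_near[OF i, of x "x + t"] by (simp add: p_def c_def)
  next
    case False
    then have "t < 0" using \<open>t \<noteq> 0\<close> by simp
    moreover have "norm (p - t *\<^sub>R y i) = norm (prim x - prim (x + t) - (x - (x + t)) *\<^sub>R y i)"
      by (subst norm_minus_cancel[symmetric]) (simp add: p_def algebra_simps)
    ultimately show ?thesis using prim_diff_near[OF i, of "x + t" x] by (simp add: c_def)
  qed
  then have "norm (p - t *\<^sub>R y i) / \<bar>t\<bar> \<le> spread * (\<bar>t\<bar> - c * sgn t) / \<bar>t\<bar>"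
    by (rule divide_right_mono) simp
  also have "spread * (\<bar>t\<bar> - c * sgn t) / \<bar>t\<bar> = spread * (1 - c / t)"
    using \<open>t \<noteq> 0\<close> by (cases "t > 0") (auto simp: field_simps)
  also have "norm (p - t *\<^sub>R y i) / \<bar>t\<bar> = norm (p /\<^sub>R t - y i)"
  proof -
    have "p /\<^sub>R t - y i = (p - t *\<^sub>R y i) /\<^sub>R t" using \<open>t \<noteq> 0\<close> by (simp add: scaleR_diff_right)
    then show ?thesis by (simp add: divide_inverse mult.commute)
  qed
  finally show ?thesis by (simp add: p_def c_def)
qed

lemma prim_has_derivative:
  assumes i: "i \<in> I" and "((\<lambda>t. (cum (A i) (x + t) - cum (A i) x) / t) \<longlongrightarrow> 1) (at 0)"
  shows "((\<lambda>t. (prim (x + t) - prim x) /\<^sub>R t) \<longlongrightarrow> y i) (at 0)"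
proof (rule LIM_zero_cancel, rule Lim_null_comparison)
  show "\<forall>\<^sub>F t in at 0. norm ((prim (x + t) - prim x) /\<^sub>R t - y i)
      \<le> spread * (1 - (cum (A i) (x + t) - cum (A i) x) / t)"
    using prim_slope_near[OF i] by (auto simp: eventually_at intro!: exI[of _ 1])
  show "((\<lambda>t. spread * (1 - (cum (A i) (x + t) - cum (A i) x) / t)) \<longlongrightarrow> 0) (at 0)"
    using tendsto_mult[OF tendsto_const tendsto_diff[OF tendsto_const assms(2)], of spread 1] by simp
qed

section \<open>Convexity and compactness of the slopes of the primitive\<close>

lemma prim_slope_in_hull:
  assumes "a < b"
  shows "(prim b - prim a) /\<^sub>R (b - a) \<in> convex hull (y ` {i \<in> I. \<not> negligible (A i)})"
proof -
  let ?J = "{i \<in> I. \<not> negligible (A i)}"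
  define w where "w j = (cum (A j) b - cum (A j) a) / (b - a)" for j
  have w: "0 \<le> w j" if "j \<in> I" for j
    using cum_mono[OF A_sets[OF that], of a b] assms by (simp add: w_def)
  have w0: "w j = 0" if "j \<in> I - ?J" for j
  proof -
    have "negligible (A j \<inter> {a<..b})" using that by (intro negligible_Int) auto
    then show ?thesis using that assms
      by (simp add: w_def cum_diff A_sets negligible_imp_measure0)
  qed
  have "sum w ?J = sum w I" using w0 finite_I by (intro sum.mono_neutral_left) auto
  also have "\<dots> = 1" using sum_cum_diff[of a b] assms
    by (simp add: w_def flip: sum_divide_distrib)
  finally have sw: "sum w ?J = 1" .
  have "(prim b - prim a) /\<^sub>R (b - a) = (\<Sum>j\<in>I. w j *\<^sub>R y j)"
    by (simp add: prim_diff scaleR_sum_right w_def divide_inverse mult.commute)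
  also have "\<dots> = (\<Sum>j\<in>?J. w j *\<^sub>R y j)"
    using w0 finite_I by (intro sum.mono_neutral_right) auto
  also have "\<dots> \<in> convex hull (y ` ?J)"
    using w sw finite_I by (intro convex_sum) (auto intro: hull_inc)
  finally show ?thesis .
qed

text \<open>Slopes are divided by a norm, so exchanging the two points flips the sign; hence the
  mirrored hull.\<close>

lemma prim_slopes_subset:
  "slopes prim \<subseteq> convex hull (y ` {i \<in> I. \<not> negligible (A i)}) \<union>
     uminus ` (convex hull (y ` {i \<in> I. \<not> negligible (A i)}))"
proof
  fix s assume "s \<in> slopes prim"
  then obtain a b where ab: "s = (prim a - prim b) /\<^sub>R norm (a - b)" "a \<noteq> b"
    by (auto simp: slopes_def)
  show "s \<in> convex hull (y ` {i \<in> I. \<not> negligible (A i)}) \<union>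
     uminus ` (convex hull (y ` {i \<in> I. \<not> negligible (A i)}))"
  proof (cases "b < a")
    case True
    then show ?thesis using prim_slope_in_hull[OF True] ab by simp
  next
    case False
    then have "a < b" using ab by simp
    moreover from this have "s = - ((prim b - prim a) /\<^sub>R (b - a))"
      using ab by (simp add: scaleR_diff_right)
    ultimately show ?thesis using prim_slope_in_hull[of a b] by blast
  qed
qed

text \<open>The ball of radius \<open>M\<close> is convex and symmetric, so it contains both the
  hull and its mirror image.\<close>

lemma prim_lipschitz:
  assumes "\<And>i. i \<in> I \<Longrightarrow> \<not> negligible (A i) \<Longrightarrow> norm (y i) \<le> M"
  shows "norm (prim a - prim b) \<le> M * norm (a - b)"
proof (cases "a = b")
  case False
  have "convex hull (y ` {i \<in> I. \<not> negligible (A i)}) \<subseteq> cball 0 M"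
    using assms by (intro hull_minimal) auto
  moreover have "(prim a - prim b) /\<^sub>R norm (a - b) \<in> slopes prim"
    using False by (auto simp: slopes_def)
  ultimately have "norm ((prim a - prim b) /\<^sub>R norm (a - b)) \<le> M"
    using prim_slopes_subset by fastforce
  then show ?thesis using False by (simp add: divide_simps mult.commute)
qed simp

text \<open>The convex hull of finitely many points is compact, and so is its union with its
  negative; the closure of the slopes is a closed subset of that union.\<close>

lemma prim_lip0K: "lip0K prim"
proof -
  let ?H = "convex hull (y ` {i \<in> I. \<not> negligible (A i)})"
  have "norm (prim a - prim b) \<le> (\<Sum>i\<in>I. norm (y i)) * norm (a - b)" for a b
    using finite_I by (intro prim_lipschitz) (auto intro: member_le_sum)
  moreover have "prim 0 = 0" by (simp add: prim_def cum_def)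
  ultimately have "lip0 prim" by (auto simp: lip0_def)
  have H: "compact ?H" using finite_I by (intro finite_imp_compact_convex_hull) auto
  then have cpt: "compact (?H \<union> uminus ` ?H)" by (intro compact_Un compact_negations)
  then have "closure (slopes prim) \<subseteq> ?H \<union> uminus ` ?H"
    by (intro closure_minimal prim_slopes_subset compact_imp_closed)
  then have "compact (closure (slopes prim))"
    using compact_Int_closed[OF cpt closed_closure, of "slopes prim"] by (simp only: inf.absorb2)
  with \<open>lip0 prim\<close> show ?thesis by (simp add: lip0K_def)
qed

section \<open>Approximation by the primitive through continuity induction\<close>

text \<open>Starting in \<open>A i\<close>, a suitable short step moves \<open>f\<close> by nearly t
  times \<open>y i\<close>, and also \<open>prim\<close>, except for the portion of the step outside
  \<open>A i\<close>. Open neighbourhoods of the pieces confine that portion to a set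
  \<open>W\<close> of measure at most \<open>card I * e\<close>. The steps are chained by
  \<open>closed_real_induct\<close>, and then \<open>e\<close> tends to 0.\<close>

lemma prim_approx:
  fixes f :: "real \<Rightarrow> 'b"
  assumes f: "continuous_on UNIV f" and "a \<le> b"
    and near: "\<And>i x r. \<lbrakk>i \<in> I; x \<in> A i; 0 < r\<rbrakk> \<Longrightarrow>
      \<exists>t. 0 < t \<and> t < r \<and> norm ((f (x + t) - f x) /\<^sub>R t - y i) \<le> \<delta>"
  shows "norm ((f b - prim b) - (f a - prim a)) \<le> \<delta> * (b - a)"
proof -
  define u where "u x = f x - prim x" for x
  have contu: "continuous_on T u" for T
    unfolding u_def prim_def
    by (intro continuous_intros continuous_on_cum A_sets continuous_on_subset[OF f]) auto
  have le: "norm (u b - u a) \<le> \<delta> * (b - a) + spread * (card I * e)" if e: "e > 0" for e :: real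
  proof -
    have "\<forall>i\<in>I. \<exists>U. open U \<and> A i \<subseteq> U \<and> U - A i \<in> lmeasurable \<and> emeasure lebesgue (U - A i) < ennreal e"
    proof
      fix i assume "i \<in> I"
      then show "\<exists>U. open U \<and> A i \<subseteq> U \<and> U - A i \<in> lmeasurable \<and> emeasure lebesgue (U - A i) < ennreal e"
        using sets_lebesgue_outer_open[OF A_sets e, of i] by metis
    qed
    then obtain U where U: "\<And>i. i \<in> I \<Longrightarrow> open (U i)" "\<And>i. i \<in> I \<Longrightarrow> A i \<subseteq> U i"
      "\<And>i. i \<in> I \<Longrightarrow> U i - A i \<in> lmeasurable"
      "\<And>i. i \<in> I \<Longrightarrow> emeasure lebesgue (U i - A i) < ennreal e"
      by metis
    define W where "W = (\<Union>i\<in>I. U i - A i)"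
    have W: "W \<in> lmeasurable" unfolding W_def using U finite_I by (intro fmeasurable.finite_UN) auto
    then have Ws: "W \<in> sets lebesgue" by (rule fmeasurableD)
    have "measure lebesgue W \<le> (\<Sum>i\<in>I. measure lebesgue (U i - A i))"
      unfolding W_def using U finite_I by (intro measure_UNION_le) (auto simp: fmeasurableD)
    also have "\<dots> \<le> (\<Sum>i\<in>I. e)"
      using U(4) e by (intro sum_mono) (simp add: measure_def enn2real_leI less_imp_le)
    finally have We: "measure lebesgue W \<le> card I * e" by simp
    \<comment> \<open>Charging the error to the increment of \<open>cum W\<close> makes it additive
      along the steps, so the total stays below \<open>spread\<close> times the measure of
      \<open>W\<close> however many steps are taken.\<close>
    have "norm (u b - u a) \<le> \<delta> * (b - a) + spread * (cum W b - cum W a)"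
    proof (rule closed_real_induct[OF \<open>a \<le> b\<close>])
      show "closed {x \<in> {a..b}. norm (u x - u a) \<le> \<delta> * (x - a) + spread * (cum W x - cum W a)}"
        by (intro continuous_on_closed_Collect_le continuous_intros contu continuous_on_cum Ws)
      fix c assume c: "a \<le> c" "c < b"
        "norm (u c - u a) \<le> \<delta> * (c - a) + spread * (cum W c - cum W a)"
      obtain i where i: "i \<in> I" "c \<in> A i" using A_cover by blast
      then obtain s where s: "s > 0" "ball c s \<subseteq> U i" using U by (meson openE subsetD)
      \<comment> \<open>Below \<open>s\<close> the step stays inside \<open>U i\<close>, so whatever
        it meets outside \<open>A i\<close> belongs to \<open>W\<close>; below \<open>b - c\<close>
        it does not overshoot \<open>b\<close>.\<close>
      obtain t where t: "0 < t" "t < min s (b - c)" "norm ((f (c + t) - f c) /\<^sub>R t - y i) \<le> \<delta>"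
        using near[OF i, of "min s (b - c)"] s c by auto
      have "norm (f (c + t) - f c - t *\<^sub>R y i) = t * norm ((f (c + t) - f c) /\<^sub>R t - y i)"
      proof -
        have "f (c + t) - f c - t *\<^sub>R y i = t *\<^sub>R ((f (c + t) - f c) /\<^sub>R t - y i)"
          using t by (simp add: scaleR_diff_right)
        then show ?thesis using t by (simp only: norm_scaleR abs_of_pos)
      qed
      then have f_step: "norm (f (c + t) - f c - t *\<^sub>R y i) \<le> \<delta> * t"
        using t by (simp add: mult.commute[of \<delta>])
      have "{c<..c + t} \<subseteq> U i" using s t by (auto simp: dist_real_def subset_iff)
      then have "{c<..c + t} \<subseteq> (A i \<inter> {c<..c + t}) \<union> (W \<inter> {c<..c + t})"
        using i by (auto simp: W_def)
      then have "measure lebesgue {c<..c + t} \<le> measure lebesgue ((A i \<inter> {c<..c + t}) \<union> (W \<inter> {c<..c + t}))"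
        using lmeasurable_Int_interval[OF A_sets[OF i(1)]] lmeasurable_Int_interval[OF Ws]
        by (intro measure_mono_fmeasurable) auto
      also have "\<dots> \<le> measure lebesgue (A i \<inter> {c<..c + t}) + measure lebesgue (W \<inter> {c<..c + t})"
        using A_sets[OF i(1)] Ws by (intro measure_Un_le) auto
      finally have "t - (cum (A i) (c + t) - cum (A i) c) \<le> cum W (c + t) - cum W c"
        using t A_sets[OF i(1)] Ws by (simp add: cum_diff)
      then have "spread * (t - (cum (A i) (c + t) - cum (A i) c)) \<le> spread * (cum W (c + t) - cum W c)"
        using spread_nonneg by (rule mult_left_mono)
      then have g_step: "norm (prim (c + t) - prim c - t *\<^sub>R y i) \<le> spread * (cum W (c + t) - cum W c)"
        using prim_diff_near[OF i(1), of c "c + t"] t by simp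
      have "u (c + t) - u a = (f (c + t) - f c - t *\<^sub>R y i) - (prim (c + t) - prim c - t *\<^sub>R y i) + (u c - u a)"
        by (simp add: u_def)
      also have "norm \<dots> \<le> norm (f (c + t) - f c - t *\<^sub>R y i) + norm (prim (c + t) - prim c - t *\<^sub>R y i) + norm (u c - u a)"
        by (meson add_right_mono norm_triangle_ineq norm_triangle_ineq4 order_trans)
      also have "\<dots> \<le> \<delta> * t + spread * (cum W (c + t) - cum W c) + (\<delta> * (c - a) + spread * (cum W c - cum W a))"
        by (intro add_mono f_step g_step c(3))
      also have "\<dots> = \<delta> * (c + t - a) + spread * (cum W (c + t) - cum W a)"
        by (simp add: algebra_simps)
      finally have "norm (u (c + t) - u a) \<le> \<delta> * (c + t - a) + spread * (cum W (c + t) - cum W a)" .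
      with t show "\<exists>d. c < d \<and> d \<le> b \<and> norm (u d - u a) \<le> \<delta> * (d - a) + spread * (cum W d - cum W a)"
        by (intro exI[of _ "c + t"]) auto
    qed simp
    moreover have "cum W b - cum W a \<le> measure lebesgue W"
      using W Ws \<open>a \<le> b\<close> by (auto simp: cum_diff intro!: measure_mono_fmeasurable)
    ultimately show ?thesis
      using We mult_left_mono[OF _ spread_nonneg, of "cum W b - cum W a" "card I * e"] by linarith
  qed
  have "norm (u b - u a) \<le> \<delta> * (b - a)"
  proof (rule tendsto_lowerbound)
    have "((\<lambda>e::real. \<delta> * (b - a) + spread * (card I * e)) \<longlongrightarrow> \<delta> * (b - a) + spread * (real (card I) * 0)) (at_right 0)"
      by (intro tendsto_intros)
    then show "((\<lambda>e::real. \<delta> * (b - a) + spread * (card I * e)) \<longlongrightarrow> \<delta> * (b - a)) (at_right 0)" by simp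
    show "\<forall>\<^sub>F e::real in at_right 0. norm (u b - u a) \<le> \<delta> * (b - a) + spread * (card I * e)"
      using eventually_at_right_less[of 0] by eventually_elim (rule le)
  qed simp
  then show ?thesis by (simp add: u_def)
qed

end

section \<open>Lipschitz norms and norm attainment of the primitive\<close>

lemma lip_norm_le:
  fixes f :: "real \<Rightarrow> 'b::real_normed_vector"
  assumes "\<And>x y. norm (f x - f y) \<le> L * norm (x - y)"
  shows "lip_norm f \<le> L"
  unfolding lip_norm_def
proof (rule cSup_least)
  show "{norm (f x - f y) / norm (x - y) |x y. x \<noteq> y} \<noteq> {}"
    using zero_neq_one[where 'a = real] by blast
qed (use assms in \<open>auto simp: pos_divide_le_eq\<close>)

text \<open>Each difference quotient has norm at most the supremum, and norms pass to the limit. The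
  assumption \<open>lip0 f\<close> bounds the set of ratios, so that its \<open>Sup\<close> is a
  genuine upper bound.\<close>

lemma derivative_le_lip_norm:
  fixes f :: "real \<Rightarrow> 'b::real_normed_vector"
  assumes "lip0 f" and d: "((\<lambda>t. (f (x + t) - f x) /\<^sub>R t) \<longlongrightarrow> d) (at 0)"
  shows "norm d \<le> lip_norm f"
proof (rule tendsto_upperbound[OF tendsto_norm[OF d]])
  obtain L where L: "\<And>x y. norm (f x - f y) \<le> L * norm (x - y)"
    using assms by (auto simp: lip0_def)
  have bdd: "bdd_above {norm (f x - f y) / norm (x - y) |x y. x \<noteq> y}"
    using L by (intro bdd_aboveI[of _ L]) (auto simp: pos_divide_le_eq)
  have "norm ((f (x + t) - f x) /\<^sub>R t) \<le> lip_norm f" if "t \<noteq> 0" for t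
  proof -
    have "norm ((f (x + t) - f x) /\<^sub>R t) = norm (f (x + t) - f x) / norm ((x + t) - x)"
      by (simp add: divide_inverse mult.commute)
    also have "\<dots> \<le> lip_norm f"
      unfolding lip_norm_def using that
      by (intro cSup_upper[OF _ bdd] CollectI exI[of _ "x + t"] exI[of _ x]) auto
    finally show ?thesis .
  qed
  then show "\<forall>\<^sub>F t in at 0. norm ((f (x + t) - f x) /\<^sub>R t) \<le> lip_norm f"
    by (auto simp: eventually_at intro!: exI[of _ 1])
qed simp

text \<open>Take \<open>y i\<close> of largest norm among the non-negligible pieces. At a density
  point of \<open>A i\<close> it is the derivative, hence \<open>norm (y i)\<close> is at most
  \<open>lip_norm prim\<close>; \<open>prim_lipschitz\<close> gives the converse.\<close>

lemma (in simple_partition) prim_DK: "DK prim"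
proof -
  define J where "J = {i \<in> I. \<not> negligible (A i)}"
  have "finite J" using finite_I by (simp add: J_def)
  \<comment> \<open>Otherwise the hull containing the slope between 0 and 1 would be empty.\<close>
  moreover have "J \<noteq> {}" using prim_slope_in_hull[of 0 1] by (auto simp flip: J_def)
  ultimately have "Max ((\<lambda>j. norm (y j)) ` J) \<in> (\<lambda>j. norm (y j)) ` J"
    by (intro Max_in) auto
  then obtain i where "i \<in> J" "Max ((\<lambda>j. norm (y j)) ` J) = norm (y i)" by auto
  with \<open>finite J\<close> have i: "i \<in> J" "\<And>j. j \<in> J \<Longrightarrow> norm (y j) \<le> norm (y i)"
    by (auto simp flip: \<open>_ = norm (y i)\<close>)
  then have "i \<in> I" "\<not> negligible (A i)" by (auto simp: J_def)
  then obtain x where "((\<lambda>t. (cum (A i) (x + t) - cum (A i) x) / t) \<longlongrightarrow> 1) (at 0)"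
    using density_point_exists[OF A_sets] by metis
  with \<open>i \<in> I\<close> have lim: "((\<lambda>t. (prim (x + t) - prim x) /\<^sub>R t) \<longlongrightarrow> y i) (at 0)"
    by (rule prim_has_derivative)
  have lip: "lip0 prim" using prim_lip0K by (simp add: lip0K_def)
  have "lip_norm prim \<le> norm (y i)"
    using i by (intro lip_norm_le prim_lipschitz) (auto simp: J_def)
  with derivative_le_lip_norm[OF lip lim] have "norm (y i) = lip_norm prim" by simp
  with lip lim have "DD prim"
    unfolding DD_def by (intro conjI exI[of _ x] exI[of _ 1] exI[of _ "y i"]) auto
  then show ?thesis using prim_lip0K by (simp add: DK_def)
qed

theorem theorem3p5:
  fixes f :: "real \<Rightarrow> 'b::banach"
  assumes "lip0K f"
    and "\<epsilon> > 0"
  shows "\<exists>g :: real \<Rightarrow> 'b. DK g \<and> lip_norm (\<lambda>x. f x - g x) < \<epsilon>"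
proof -
  \<comment> \<open>Halving leaves room for the strict inequality, since the approximation only
    gives \<le> \<delta>.\<close>
  define \<delta> where "\<delta> = \<epsilon> / 2"
  have \<delta>: "0 < \<delta>" "\<delta> < \<epsilon>" using assms by (auto simp: \<delta>_def)
  obtain L where L: "\<And>x y. norm (f x - f y) \<le> L * norm (x - y)"
    using assms by (auto simp: lip0K_def lip0_def)
  have "dist (f x) (f y) \<le> \<bar>L\<bar> * dist x y" for x y
    using L[of x y] mult_right_mono[OF abs_ge_self[of L], of "norm (x - y)"] by (simp add: dist_norm)
  then have "\<bar>L\<bar>-lipschitz_on UNIV f" by (intro lipschitz_onI) auto
  then have cont: "continuous_on UNIV f" by (rule lipschitz_on_continuous_on)
  have "compact (closure (slopes f))" using assms by (simp add: lip0K_def)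
  then obtain k where k: "finite k" "closure (slopes f) \<subseteq> (\<Union>x\<in>k. ball x \<delta>)"
    unfolding compact_eq_totally_bounded using \<delta> by metis
  obtain n :: nat and y where y: "k = y ` {i. i < n}"
    using finite_imp_nat_seg_image_inj_on[OF k(1)] by metis
  \<comment> \<open>Only positive \<open>t\<close> occur because the continuity induction moves to
    the right; the strict inequality makes each condition open. Indexing by naturals allows
    \<open>disjointed\<close> to remove overlaps.\<close>
  define E where "E i = {x. \<forall>m. \<exists>t\<in>{t. 0 < t \<and> t < 1 / Suc m}. norm ((f (x + t) - f x) /\<^sub>R t - y i) < \<delta>}" for i
  define A where "A = disjointed E"
  have E_sets: "E i \<in> sets lebesgue" for i
  proof -
    have "E i \<in> sets borel" unfolding E_def by (rule frequent_slope_set_borel[OF cont])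
    then show ?thesis by simp
  qed
  \<comment> \<open>If \<open>x\<close> were in no \<open>E i\<close>, its right slopes would avoid
    every one of the finitely many balls at all sufficiently small scales, although each slope lies
    in some ball.\<close>
  have E_cover: "x \<in> (\<Union>i\<in>{0..<n}. E i)" for x
  proof (rule ccontr)
    assume "\<not> ?thesis"
    then have "\<forall>i<n. \<exists>m. \<forall>t. 0 < t \<longrightarrow> t < 1 / Suc m \<longrightarrow> \<not> norm ((f (x + t) - f x) /\<^sub>R t - y i) < \<delta>"
      unfolding E_def by force
    then obtain m :: "nat \<Rightarrow> nat" where m: "\<And>i t. \<lbrakk>i < n; 0 < t; t < 1 / Suc (m i)\<rbrakk> \<Longrightarrow>
        \<not> norm ((f (x + t) - f x) /\<^sub>R t - y i) < \<delta>"
      by metis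
    \<comment> \<open>The sum dominates every \<open>m i\<close>, and the second \<open>Suc\<close>
      in \<open>t\<close> makes it strictly smaller than each \<open>1 / Suc (m i)\<close>.\<close>
    define M where "M = (\<Sum>i<n. m i)"
    define t :: real where "t = 1 / Suc (Suc M)"
    have t: "0 < t" by (simp add: t_def)
    have "(f (x + t) - f x) /\<^sub>R norm (x + t - x) \<in> slopes f"
      unfolding slopes_def using t by (intro CollectI exI[of _ "x + t"] exI[of _ x]) auto
    then have "(f (x + t) - f x) /\<^sub>R t \<in> (\<Union>x\<in>k. ball x \<delta>)"
      using k(2) closure_subset[of "slopes f"] t by (simp add: subset_iff)
    then obtain i where i: "i < n" "norm ((f (x + t) - f x) /\<^sub>R t - y i) < \<delta>"
      using y by (auto simp: dist_norm norm_minus_commute)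
    have "m i \<le> M" unfolding M_def using i by (intro member_le_sum) auto
    then have "t < 1 / Suc (m i)" unfolding t_def by (intro divide_strict_left_mono) auto
    with m[OF i(1) t] i(2) show False by blast
  qed
  interpret simple_partition "{0..<n}" A y
  proof
    show "A i \<in> sets lebesgue" for i
      using sets.range_disjointed_sets[of E lebesgue] E_sets by (auto simp: A_def)
    show "disjoint_family_on A {0..<n}"
      using disjoint_family_disjointed[of E] by (auto simp: A_def disjoint_family_on_def)
    show "(\<Union>i\<in>{0..<n}. A i) = UNIV"
      using E_cover by (auto simp: A_def finite_UN_disjointed_eq)
  qed simp
  have near: "\<exists>t. 0 < t \<and> t < r \<and> norm ((f (x + t) - f x) /\<^sub>R t - y i) \<le> \<delta>"
    if "x \<in> A i" "0 < r" for i x r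
  proof -
    obtain m where m: "1 / Suc m < r" using nat_approx_posE[OF \<open>0 < r\<close>] by metis
    have "x \<in> E i" using that disjointed_subset[of E i] by (auto simp: A_def)
    then obtain t where "0 < t" "t < 1 / Suc m" "norm ((f (x + t) - f x) /\<^sub>R t - y i) < \<delta>"
      unfolding E_def by blast
    with m show ?thesis by (intro exI[of _ t]) auto
  qed
  have le: "norm ((f b - prim b) - (f a - prim a)) \<le> \<delta> * (b - a)" if "a \<le> b" for a b
    using prim_approx[OF cont that] near by blast
  have "norm ((f a - prim a) - (f b - prim b)) \<le> \<delta> * norm (a - b)" for a b
  proof (cases "a \<le> b")
    case True
    then show ?thesis using le[of a b] by (simp add: norm_minus_commute)
  next
    case False
    then show ?thesis using le[of b a] by simp
  qed
  then have "lip_norm (\<lambda>x. f x - prim x) \<le> \<delta>" by (rule lip_norm_le)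
  then have "lip_norm (\<lambda>x. f x - prim x) < \<epsilon>" using \<delta>(2) by (rule order.strict_trans1)
  with prim_DK show ?thesis by blast
qed

end
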